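(* Let $p,q\in\beta N$. The following conditions are equivalent: (i) $p\mid_L q$; (ii) $C(p)\subseteq q$; (iii) $C(p)\subseteq C(q)$.
   Context: $N=\{1,2,3,\dots\}$ and $\beta N$ is the set of all ultrafilters on $N$. For $A\subseteq N$ and $n\in N$, $A/n=\{m\in N:mn\in A\}$. Multiplication on $\beta N$ (extending multiplication on $N$, where each $n\in N$ is identified with the principal ultrafilter at $n$) is defined by: $A\in p\cdot q$ if and only if $\{n\in N:A/n\in q\}\in p$. For $p,q\in\beta N$, $p\mid_L q$ means that there is $r\in\beta N$ such that $q=rp$. For $p\in\beta N$, $C(p)=\{A\subseteq N:\forall n\in N\ \ A/n\in p\}$. *)

theory Defs
  imports Main
begin

text \<open>
  HOL's type \<^typ>\<open>nat\<close> contains \<open>0\<close>, so the positive integers are a carrier set and all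
  families of sets below consist of subsets of it.
\<close>

abbreviation posnat :: "nat set" where
  "posnat \<equiv> {1..}"

text \<open>
  Ultrafilters are families of sets rather than elements of the library type \<open>'a filter\<close>, so
  that \<open>A \<in> p\<close> and \<open>C(p) \<subseteq> q\<close> can be read literally. The lemma \<open>ultrafilter_on_iff_filter\<close>
  relates the two.
\<close>

definition ultrafilter_on :: "'a set \<Rightarrow> 'a set set \<Rightarrow> bool" where
  "ultrafilter_on X p \<longleftrightarrow>
     p \<subseteq> Pow X \<and> X \<in> p \<and> {} \<notin> p \<and>
     (\<forall>A\<in>p. \<forall>B\<in>p. A \<inter> B \<in> p) \<and>
     (\<forall>A\<in>p. \<forall>B. A \<subseteq> B \<and> B \<subseteq> X \<longrightarrow> B \<in> p) \<and>
     (\<forall>A. A \<subseteq> X \<longrightarrow> A \<in> p \<or> X - A \<in> p)"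

definition betaN :: "nat set set set" where
  "betaN = {p. ultrafilter_on posnat p}"

definition principal_ultrafilter :: "nat \<Rightarrow> nat set set" where
  "principal_ultrafilter n = {A. A \<subseteq> posnat \<and> n \<in> A}"

definition set_quotient :: "nat set \<Rightarrow> nat \<Rightarrow> nat set" where
  "set_quotient A n = {m \<in> posnat. m * n \<in> A}"

definition beta_mult :: "nat set set \<Rightarrow> nat set set \<Rightarrow> nat set set" where
  "beta_mult p q = {A. A \<subseteq> posnat \<and> {n \<in> posnat. set_quotient A n \<in> q} \<in> p}"

definition left_dvd :: "nat set set \<Rightarrow> nat set set \<Rightarrow> bool" where
  "left_dvd p q \<longleftrightarrow> (\<exists>r\<in>betaN. q = beta_mult r p)"

definition C :: "nat set set \<Rightarrow> nat set set" where
  "C p = {A. A \<subseteq> posnat \<and> (\<forall>n\<in>posnat. set_quotient A n \<in> p)}"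

lemma ultrafilter_on_iff_filter:
  "ultrafilter_on X p \<longleftrightarrow>
     (\<exists>F. F \<le> principal X \<and> F \<noteq> bot \<and>
          (\<forall>P. eventually P F \<or> eventually (\<lambda>x. \<not> P x) F) \<and>
          p = {A. A \<subseteq> X \<and> eventually (\<lambda>x. x \<in> A) F})"
proof
  assume u: "ultrafilter_on X p"
  define F where "F = Abs_filter (\<lambda>P. {x \<in> X. P x} \<in> p)"
  have *: "is_filter (\<lambda>P. {x \<in> X. P x} \<in> p)"
  proof
    show "{x \<in> X. True} \<in> p"
      using u by (simp add: ultrafilter_on_def)
  next
    fix P Q assume "{x \<in> X. P x} \<in> p" "{x \<in> X. Q x} \<in> p"
    moreover have "{x \<in> X. P x \<and> Q x} = {x \<in> X. P x} \<inter> {x \<in> X. Q x}" by auto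
    ultimately show "{x \<in> X. P x \<and> Q x} \<in> p"
      using u by (simp add: ultrafilter_on_def)
  next
    fix P Q :: "'a \<Rightarrow> bool" assume "\<forall>x. P x \<longrightarrow> Q x" and P: "{x \<in> X. P x} \<in> p"
    then have "{x \<in> X. P x} \<subseteq> {x \<in> X. Q x}" by auto
    then show "{x \<in> X. Q x} \<in> p"
      using u P Collect_subset[of X Q] unfolding ultrafilter_on_def by blast
  qed
  have ev: "eventually P F \<longleftrightarrow> {x \<in> X. P x} \<in> p" for P
    unfolding F_def by (rule eventually_Abs_filter[OF *])
  have "F \<le> principal X"
    using u by (simp add: le_principal ev ultrafilter_on_def)
  moreover have "F \<noteq> bot"
    using u by (simp add: trivial_limit_def ev ultrafilter_on_def)
  moreover have "eventually P F \<or> eventually (\<lambda>x. \<not> P x) F" for P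
  proof -
    have "{x \<in> X. \<not> P x} = X - {x \<in> X. P x}" by auto
    then show ?thesis
      using u Collect_subset[of X P] unfolding ev ultrafilter_on_def by simp
  qed
  moreover have "p = {A. A \<subseteq> X \<and> eventually (\<lambda>x. x \<in> A) F}"
  proof -
    have "{x \<in> X. x \<in> A} = A" if "A \<subseteq> X" for A using that by auto
    moreover have "A \<subseteq> X" if "A \<in> p" for A
      using u that by (auto simp: ultrafilter_on_def)
    ultimately show ?thesis by (auto simp: ev)
  qed
  ultimately show "\<exists>F. F \<le> principal X \<and> F \<noteq> bot \<and>
          (\<forall>P. eventually P F \<or> eventually (\<lambda>x. \<not> P x) F) \<and>
          p = {A. A \<subseteq> X \<and> eventually (\<lambda>x. x \<in> A) F}"
    by blast
next
  assume "\<exists>F. F \<le> principal X \<and> F \<noteq> bot \<and>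
          (\<forall>P. eventually P F \<or> eventually (\<lambda>x. \<not> P x) F) \<and>
          p = {A. A \<subseteq> X \<and> eventually (\<lambda>x. x \<in> A) F}"
  then obtain F where F: "eventually (\<lambda>x. x \<in> X) F" "F \<noteq> bot"
      "\<And>P. eventually P F \<or> eventually (\<lambda>x. \<not> P x) F"
    and p: "p = {A. A \<subseteq> X \<and> eventually (\<lambda>x. x \<in> A) F}"
    by (auto simp: le_principal)
  show "ultrafilter_on X p"
    unfolding ultrafilter_on_def
  proof (intro conjI ballI allI impI)
    show "{} \<notin> p" using F(2) by (simp add: p trivial_limit_def)
  next
    fix A B assume "A \<in> p" "A \<subseteq> B \<and> B \<subseteq> X"
    then show "B \<in> p" by (auto simp: p elim: eventually_mono)
  next
    fix A assume "A \<subseteq> X"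
    then show "A \<in> p \<or> X - A \<in> p"
      using F(1) F(3)[of "\<lambda>x. x \<in> A"] by (auto simp: p eventually_conj_iff)
  qed (use F(1) in \<open>auto simp: p eventually_conj_iff\<close>)
qed

lemma principal_ultrafilter_in_betaN:
  assumes "n \<in> posnat"
  shows "principal_ultrafilter n \<in> betaN"
  using assms by (auto simp: betaN_def ultrafilter_on_def principal_ultrafilter_def)

lemma beta_mult_principal:
  assumes "m \<in> posnat" "n \<in> posnat"
  shows "beta_mult (principal_ultrafilter m) (principal_ultrafilter n)
           = principal_ultrafilter (m * n)"
  using assms
  by (auto simp: beta_mult_def principal_ultrafilter_def set_quotient_def mult.commute)

lemma beta_mult_in_betaN:
  assumes p: "p \<in> betaN" and q: "q \<in> betaN"
  shows "beta_mult p q \<in> betaN"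
proof -
  let ?S = "\<lambda>A. {n \<in> posnat. set_quotient A n \<in> q}"
  have Pp: "posnat \<in> p" "{} \<notin> p" "\<And>A B. A \<in> p \<Longrightarrow> B \<in> p \<Longrightarrow> A \<inter> B \<in> p"
    "\<And>A B. A \<in> p \<Longrightarrow> A \<subseteq> B \<Longrightarrow> B \<subseteq> posnat \<Longrightarrow> B \<in> p"
    "\<And>A. A \<subseteq> posnat \<Longrightarrow> A \<in> p \<or> posnat - A \<in> p"
    using p unfolding betaN_def ultrafilter_on_def by blast+
  have Qq: "posnat \<in> q" "{} \<notin> q" "\<And>A B. A \<in> q \<Longrightarrow> B \<in> q \<Longrightarrow> A \<inter> B \<in> q"
    "\<And>A B. A \<in> q \<Longrightarrow> A \<subseteq> B \<Longrightarrow> B \<subseteq> posnat \<Longrightarrow> B \<in> q"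
    "\<And>A. A \<subseteq> posnat \<Longrightarrow> A \<in> q \<or> posnat - A \<in> q"
    using q unfolding betaN_def ultrafilter_on_def by blast+
  have sub: "set_quotient A n \<subseteq> posnat" for A n
    by (auto simp: set_quotient_def)
  have "set_quotient posnat n = posnat" if "n \<in> posnat" for n
    using that by (auto simp: set_quotient_def)
  then have top: "?S posnat = posnat" using Qq(1) by auto
  have bot: "?S {} = {}" using Qq(2) by (auto simp: set_quotient_def)
  have int: "?S A \<inter> ?S B \<subseteq> ?S (A \<inter> B)" for A B
  proof
    fix n assume n: "n \<in> ?S A \<inter> ?S B"
    have "set_quotient (A \<inter> B) n = set_quotient A n \<inter> set_quotient B n"
      by (auto simp: set_quotient_def)
    then show "n \<in> ?S (A \<inter> B)" using n Qq(3) by auto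
  qed
  have mono: "?S A \<subseteq> ?S B" if "A \<subseteq> B" for A B
  proof
    fix n assume n: "n \<in> ?S A"
    have "set_quotient A n \<subseteq> set_quotient B n"
      using that by (auto simp: set_quotient_def)
    then show "n \<in> ?S B" using n Qq(4)[OF _ _ sub] by blast
  qed
  have compl: "posnat - ?S A \<subseteq> ?S (posnat - A)" for A
  proof
    fix n assume n: "n \<in> posnat - ?S A"
    have "set_quotient (posnat - A) n = posnat - set_quotient A n"
      using n by (auto simp: set_quotient_def)
    then show "n \<in> ?S (posnat - A)" using n Qq(5)[OF sub] by auto
  qed
  have Ssub: "?S A \<subseteq> posnat" for A by auto
  show ?thesis
    unfolding betaN_def mem_Collect_eq ultrafilter_on_def
  proof (intro conjI ballI allI impI)
    show "beta_mult p q \<subseteq> Pow posnat" by (auto simp: beta_mult_def)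
    show "posnat \<in> beta_mult p q" using top Pp(1) by (simp add: beta_mult_def)
    show "{} \<notin> beta_mult p q" using bot Pp(2) by (simp only: beta_mult_def mem_Collect_eq) simp
  next
    fix A B assume "A \<in> beta_mult p q" "B \<in> beta_mult p q"
    then show "A \<inter> B \<in> beta_mult p q"
      using Pp(4)[OF Pp(3) int Ssub] unfolding beta_mult_def by blast
  next
    fix A B assume "A \<in> beta_mult p q" "A \<subseteq> B \<and> B \<subseteq> posnat"
    then show "B \<in> beta_mult p q"
      using Pp(4)[OF _ mono Ssub] unfolding beta_mult_def by blast
  next
    fix A assume A: "A \<subseteq> posnat"
    show "A \<in> beta_mult p q \<or> posnat - A \<in> beta_mult p q"
      using A Pp(5)[OF Ssub] Pp(4)[OF _ compl Ssub] unfolding beta_mult_def by blast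
  qed
qed

end

theory Submission
  imports Defs
begin

text \<open>
  Write \<open>S(A) = {n. A/n \<in> p}\<close>, so that \<open>A \<in> r \<cdot> p\<close> means \<open>S(A) \<in> r\<close> and \<open>A \<in> C(p)\<close> means
  that \<open>S(A)\<close> is everything. Since \<open>(A/n)/k = A/(n k)\<close>, the family \<open>C(p)\<close> is closed under all
  quotients \<open>A \<mapsto> A/n\<close>; together with \<open>A/1 = A\<close> this makes \<open>C(p) \<subseteq> q\<close> and \<open>C(p) \<subseteq> C(q)\<close>
  equivalent. A left multiple \<open>r \<cdot> p\<close> contains \<open>C(p)\<close>, because the set of all positive integers
  belongs to \<open>r\<close>.

  The substance is the converse, where a quotient \<open>r\<close> has to be produced from \<open>C(p) \<subseteq> q\<close>.
  Any solution must contain \<open>S(A)\<close> for every \<open>A \<in> q\<close>. As \<open>p\<close> is an ultrafilter, \<open>S\<close> commutes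
  with intersections and complements. Hence the sets \<open>S(A)\<close> with \<open>A \<in> q\<close> are closed under
  intersection, and none is empty: if \<open>S(A)\<close> were empty, then \<open>S\<close> of the complement of \<open>A\<close> would be
  everything, so this complement would lie in \<open>C(p) \<subseteq> q\<close>, against \<open>A \<in> q\<close>. Extend this filter
  base to an ultrafilter \<open>r\<close> by Zorn's lemma (\<open>filter_base_extends_to_ultrafilter\<close>). Then
  \<open>q \<subseteq> r \<cdot> p\<close>, and an inclusion between ultrafilters is an equality.
\<close>

lemma ultrafilter_onD:
  assumes "ultrafilter_on X p"
  shows "A \<in> p \<Longrightarrow> A \<subseteq> X" "X \<in> p" "{} \<notin> p" "A \<in> p \<Longrightarrow> B \<in> p \<Longrightarrow> A \<inter> B \<in> p"
    "A \<in> p \<Longrightarrow> A \<subseteq> B \<Longrightarrow> B \<subseteq> X \<Longrightarrow> B \<in> p" "A \<subseteq> X \<Longrightarrow> A \<notin> p \<Longrightarrow> X - A \<in> p"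
proof -
  note p = assms[unfolded ultrafilter_on_def]
  show "A \<in> p \<Longrightarrow> A \<subseteq> X" using conjunct1[OF p] by blast
  show "X \<in> p" "{} \<notin> p" by (rule p[THEN conjunct2, THEN conjunct1]
      p[THEN conjunct2, THEN conjunct2, THEN conjunct1])+
  note p' = p[THEN conjunct2, THEN conjunct2, THEN conjunct2]
  show "A \<in> p \<Longrightarrow> B \<in> p \<Longrightarrow> A \<inter> B \<in> p" using conjunct1[OF p'] by blast
  show "A \<in> p \<Longrightarrow> A \<subseteq> B \<Longrightarrow> B \<subseteq> X \<Longrightarrow> B \<in> p"
    using p'[THEN conjunct2, THEN conjunct1] by blast
  show "A \<subseteq> X \<Longrightarrow> A \<notin> p \<Longrightarrow> X - A \<in> p"
    using p'[THEN conjunct2, THEN conjunct2] by blast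
qed

lemma ultrafilter_on_Int_iff:
  assumes "ultrafilter_on X p" "A \<subseteq> X" "B \<subseteq> X"
  shows "A \<inter> B \<in> p \<longleftrightarrow> A \<in> p \<and> B \<in> p"
  using assms ultrafilter_onD(4,5)[OF assms(1)] by (meson Int_lower1 Int_lower2)

lemma ultrafilter_on_Diff_iff:
  assumes "ultrafilter_on X p" "A \<subseteq> X"
  shows "X - A \<in> p \<longleftrightarrow> A \<notin> p"
  using ultrafilter_onD(3,4,6)[OF assms(1)] assms(2) by (metis Diff_disjoint)

text \<open>
  Families with the properties of \<open>B\<close> survive unions of chains, so \<open>B\<close> lies in a maximal one, \<open>r\<close>.
  Every \<open>A \<subseteq> X\<close> that meets all members of \<open>r\<close> belongs to \<open>r\<close>: the supersets of the sets \<open>D \<inter> A\<close>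
  with \<open>D \<in> r\<close> form a family of the same kind that contains both \<open>r\<close> and \<open>A\<close>, so by maximality it
  is \<open>r\<close>. This one criterion makes \<open>r\<close> closed under supersets, and it decides each \<open>A\<close>: a member of
  \<open>r\<close> that misses \<open>A\<close> and a member that misses \<open>X - A\<close> would have empty intersection.
\<close>

lemma filter_base_extends_to_ultrafilter:
  assumes sub: "B \<subseteq> Pow X" and ne: "B \<noteq> {}" and emp: "{} \<notin> B"
    and int: "\<And>U V. U \<in> B \<Longrightarrow> V \<in> B \<Longrightarrow> U \<inter> V \<in> B"
  obtains r where "ultrafilter_on X r" "B \<subseteq> r"
proof -
  define bases where
    "bases = {F. F \<subseteq> Pow X \<and> B \<subseteq> F \<and> {} \<notin> F \<and> (\<forall>U\<in>F. \<forall>V\<in>F. U \<inter> V \<in> F)}"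
  have "\<exists>r\<in>bases. \<forall>F\<in>bases. r \<subseteq> F \<longrightarrow> F = r"
  proof (rule subset_Zorn_nonempty)
    have "B \<in> bases" using sub emp int by (simp add: bases_def)
    then show "bases \<noteq> {}" by blast
  next
    fix Ch assume ne_Ch: "Ch \<noteq> {}" and chain: "subset.chain bases Ch"
    have Ch: "F \<subseteq> Pow X" "B \<subseteq> F" "{} \<notin> F" "U \<in> F \<Longrightarrow> V \<in> F \<Longrightarrow> U \<inter> V \<in> F"
      if "F \<in> Ch" for F U V
    proof -
      have "F \<in> bases" using chain that by (auto simp: subset_chain_def)
      then show "F \<subseteq> Pow X" "B \<subseteq> F" "{} \<notin> F" "U \<in> F \<Longrightarrow> V \<in> F \<Longrightarrow> U \<inter> V \<in> F"
        by (simp_all add: bases_def)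
    qed
    have "U \<inter> V \<in> \<Union>Ch" if UV: "U \<in> \<Union>Ch" "V \<in> \<Union>Ch" for U V
    proof -
      obtain F G where FG: "F \<in> Ch" "G \<in> Ch" "U \<in> F" "V \<in> G" using UV by blast
      then consider "F \<subseteq> G" | "G \<subseteq> F" using chain by (auto simp: subset_chain_def)
      then show ?thesis
      proof cases
        case 1
        then have "U \<inter> V \<in> G" using FG Ch(4)[OF FG(2)] by (simp add: subset_iff)
        then show ?thesis using FG by blast
      next
        case 2
        then have "U \<inter> V \<in> F" using FG Ch(4)[OF FG(1)] by (simp add: subset_iff)
        then show ?thesis using FG by blast
      qed
    qed
    moreover have "\<Union>Ch \<subseteq> Pow X" using Ch(1) by blast
    moreover have "B \<subseteq> \<Union>Ch" using ne_Ch Ch(2) by blast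
    moreover have "{} \<notin> \<Union>Ch" using Ch(3) by blast
    ultimately show "\<Union>Ch \<in> bases" by (simp add: bases_def)
  qed
  then obtain r where r: "r \<in> bases" and max: "\<And>F. F \<in> bases \<Longrightarrow> r \<subseteq> F \<Longrightarrow> F = r"
    by blast
  have r_sub: "r \<subseteq> Pow X" and r_B: "B \<subseteq> r" and r_emp: "{} \<notin> r"
    and r_int: "U \<in> r \<Longrightarrow> V \<in> r \<Longrightarrow> U \<inter> V \<in> r" for U V
    using r by (simp_all add: bases_def)
  have meets_all: "A \<in> r" if A: "A \<subseteq> X" and meets: "\<And>D. D \<in> r \<Longrightarrow> D \<inter> A \<noteq> {}" for A
  proof -
    define F where "F = {V. V \<subseteq> X \<and> (\<exists>D\<in>r. D \<inter> A \<subseteq> V)}"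
    have "U \<inter> V \<in> F" if UV: "U \<in> F" "V \<in> F" for U V
    proof -
      obtain D E where DE: "D \<in> r" "E \<in> r" "D \<inter> A \<subseteq> U" "E \<inter> A \<subseteq> V" "U \<subseteq> X"
        using UV by (auto simp: F_def)
      then have "(D \<inter> E) \<inter> A \<subseteq> U \<inter> V" by blast
      then show ?thesis using r_int[OF DE(1,2)] DE(5) unfolding F_def by blast
    qed
    moreover have r_F: "r \<subseteq> F" using r_sub by (auto simp: F_def)
    moreover have "{} \<notin> F" using meets by (auto simp: F_def)
    moreover have "F \<subseteq> Pow X" by (auto simp: F_def)
    moreover have "B \<subseteq> F" using r_B r_F by (rule subset_trans)
    ultimately have "F \<in> bases" by (simp add: bases_def)
    then have "F = r" using max r_F by blast
    moreover have "A \<in> F" using A ne r_B by (auto simp: F_def)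
    ultimately show ?thesis by simp
  qed
  have "ultrafilter_on X r"
    unfolding ultrafilter_on_def
  proof (intro conjI ballI allI impI)
    show "X \<in> r"
    proof (rule meets_all)
      fix D assume "D \<in> r"
      then show "D \<inter> X \<noteq> {}" using r_sub r_emp by (metis Int_absorb2 PowD subsetD)
    qed simp
  next
    fix U V assume U: "U \<in> r" and V: "U \<subseteq> V \<and> V \<subseteq> X"
    show "V \<in> r"
    proof (rule meets_all)
      fix D assume "D \<in> r"
      then have "D \<inter> U \<noteq> {}" using r_int[OF _ U] r_emp by metis
      then show "D \<inter> V \<noteq> {}" using V by blast
    qed (use V in simp)
  next
    fix A assume A: "A \<subseteq> X"
    show "A \<in> r \<or> X - A \<in> r"
    proof (rule ccontr)
      assume "\<not> ?thesis"
      then obtain D E where DE: "D \<in> r" "E \<in> r" "D \<inter> A = {}" "E \<inter> (X - A) = {}"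
        using meets_all[OF A] meets_all[OF Diff_subset] by metis
      have "D \<subseteq> X" using DE(1) r_sub by blast
      then have "D \<inter> E = {}" using DE(3,4) by blast
      then show False using r_int[OF DE(1,2)] r_emp by simp
    qed
  qed (use r_sub r_emp r_int in simp_all)
  then show thesis using that r_B by blast
qed

text \<open>
  An ultrafilter is maximal because it already contains \<open>X - A\<close> for every \<open>A \<subseteq> X\<close> that it omits.
\<close>

lemma ultrafilter_on_subset_imp_eq:
  assumes p: "ultrafilter_on X p" and q: "ultrafilter_on X q" and "p \<subseteq> q"
  shows "p = q"
proof
  show "q \<subseteq> p"
  proof
    fix A assume "A \<in> q"
    then have A: "A \<subseteq> X" "X - A \<notin> p"
      using ultrafilter_onD(1)[OF q] ultrafilter_on_Diff_iff[OF q] \<open>p \<subseteq> q\<close> by blast+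
    then show "A \<in> p" using ultrafilter_on_Diff_iff[OF p] by blast
  qed
qed fact

lemma set_quotient_subset: "set_quotient A n \<subseteq> posnat"
  by (auto simp: set_quotient_def)

lemma set_quotient_one: "A \<subseteq> posnat \<Longrightarrow> set_quotient A 1 = A"
  by (auto simp: set_quotient_def)

lemma set_quotient_set_quotient:
  "k \<in> posnat \<Longrightarrow> set_quotient (set_quotient A n) k = set_quotient A (k * n)"
  by (auto simp: set_quotient_def mult.assoc)

lemma set_quotient_Int: "set_quotient (A \<inter> B) n = set_quotient A n \<inter> set_quotient B n"
  by (auto simp: set_quotient_def)

lemma set_quotient_Diff:
  "n \<in> posnat \<Longrightarrow> set_quotient (posnat - A) n = posnat - set_quotient A n"
  by (auto simp: set_quotient_def)

text \<open>
  A quotient of a quotient is a quotient of the original set, so \<open>C p\<close> has this closure property for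
  every family \<open>p\<close>. It is what upgrades \<open>C p \<subseteq> q\<close> to \<open>C p \<subseteq> C q\<close>.
\<close>

lemma set_quotient_in_C:
  assumes "A \<in> C p" and n: "n \<in> posnat"
  shows "set_quotient A n \<in> C p"
proof -
  have "set_quotient (set_quotient A n) k \<in> p" if "k \<in> posnat" for k
  proof -
    have "k * n \<in> posnat" using n that by simp
    then show ?thesis
      using assms(1) that by (simp add: C_def set_quotient_set_quotient)
  qed
  then show ?thesis using set_quotient_subset unfolding C_def by blast
qed

lemma mem_C_imp_mem:
  assumes "A \<in> C q"
  shows "A \<in> q"
proof -
  have "A \<subseteq> posnat" "set_quotient A 1 \<in> q" using assms by (auto simp: C_def)
  then show ?thesis by (simp only: set_quotient_one)
qed

lemma C_subset_iff: "C p \<subseteq> q \<longleftrightarrow> C p \<subseteq> C q"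
proof
  assume sub: "C p \<subseteq> q"
  show "C p \<subseteq> C q"
  proof
    fix A assume A: "A \<in> C p"
    have "set_quotient A n \<in> q" if "n \<in> posnat" for n
      using set_quotient_in_C[OF A that] sub by blast
    moreover have "A \<subseteq> posnat" using A by (simp add: C_def)
    ultimately show "A \<in> C q" by (simp add: C_def)
  qed
qed (use mem_C_imp_mem in blast)

lemma C_subset_beta_mult:
  assumes "r \<in> betaN"
  shows "C p \<subseteq> beta_mult r p"
proof
  fix A assume A: "A \<in> C p"
  then have "{n \<in> posnat. set_quotient A n \<in> p} = posnat" by (auto simp: C_def)
  then show "A \<in> beta_mult r p"
    using A assms ultrafilter_onD(2)[of posnat r] by (simp add: beta_mult_def C_def betaN_def)
qed

text \<open>
  The quotient \<open>r\<close> is only pinned down on the sets \<open>S A\<close> with \<open>A \<in> q\<close>; any ultrafilter containing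
  them serves. The hypothesis \<open>C p \<subseteq> q\<close> enters in excluding \<open>S A = {}\<close>.
\<close>

lemma left_dvd_if_C_subset:
  assumes p: "p \<in> betaN" and q: "q \<in> betaN" and sub: "C p \<subseteq> q"
  shows "left_dvd p q"
proof -
  define S where "S A = {n \<in> posnat. set_quotient A n \<in> p}" for A
  have up: "ultrafilter_on posnat p" and uq: "ultrafilter_on posnat q"
    using p q by (simp_all add: betaN_def)
  have S_Int: "S A \<inter> S B = S (A \<inter> B)" for A B
  proof -
    have "set_quotient (A \<inter> B) n \<in> p \<longleftrightarrow> set_quotient A n \<in> p \<and> set_quotient B n \<in> p" for n
      unfolding set_quotient_Int
      by (rule ultrafilter_on_Int_iff[OF up set_quotient_subset set_quotient_subset])
    then show ?thesis by (auto simp: S_def)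
  qed
  have S_ne: "S A \<noteq> {}" if A: "A \<in> q" for A
  proof
    assume "S A = {}"
    then have "set_quotient (posnat - A) n \<in> p" if "n \<in> posnat" for n
      using that ultrafilter_on_Diff_iff[OF up set_quotient_subset]
      unfolding S_def set_quotient_Diff[OF that] by blast
    then have "posnat - A \<in> C p" unfolding C_def by blast
    then show False
      using A sub ultrafilter_on_Diff_iff[OF uq ultrafilter_onD(1)[OF uq A]] by blast
  qed
  have "posnat \<in> q" using uq by (rule ultrafilter_onD)
  obtain r where ur: "ultrafilter_on posnat r" and r: "S ` q \<subseteq> r"
  proof (rule filter_base_extends_to_ultrafilter)
    show "S ` q \<subseteq> Pow posnat" by (auto simp: S_def)
    show "S ` q \<noteq> {}" using \<open>posnat \<in> q\<close> by blast
    show "{} \<notin> S ` q" using S_ne by force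
    show "U \<inter> V \<in> S ` q" if "U \<in> S ` q" "V \<in> S ` q" for U V
    proof -
      from that obtain A A' where "A \<in> q" "A' \<in> q" "U = S A" "V = S A'" by blast
      then show ?thesis using ultrafilter_onD(4)[OF uq] by (simp add: S_Int)
    qed
  qed
  have "r \<in> betaN" using ur by (simp add: betaN_def)
  have "q \<subseteq> beta_mult r p"
  proof
    fix A assume A: "A \<in> q"
    then have "A \<subseteq> posnat" by (rule ultrafilter_onD(1)[OF uq])
    moreover have "S A \<in> r" using A r by blast
    ultimately show "A \<in> beta_mult r p" by (simp add: beta_mult_def S_def)
  qed
  moreover have "ultrafilter_on posnat (beta_mult r p)"
    using beta_mult_in_betaN[OF \<open>r \<in> betaN\<close> p] by (simp add: betaN_def)
  ultimately have "q = beta_mult r p" using uq ultrafilter_on_subset_imp_eq by blast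
  then show ?thesis using \<open>r \<in> betaN\<close> by (auto simp: left_dvd_def)
qed

theorem theorem6p1:
  fixes p q :: "nat set set"
  assumes "p \<in> betaN" and "q \<in> betaN"
  shows "(left_dvd p q \<longleftrightarrow> C p \<subseteq> q) \<and> (C p \<subseteq> q \<longleftrightarrow> C p \<subseteq> C q)"
proof
  show "left_dvd p q \<longleftrightarrow> C p \<subseteq> q"
  proof
    assume "left_dvd p q"
    then show "C p \<subseteq> q" using C_subset_beta_mult by (auto simp: left_dvd_def)
  qed (rule left_dvd_if_C_subset[OF assms])
qed (rule C_subset_iff)

end
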